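(* Let $\mathbb{F}$ be a field, let $G$ be a group, and let $X$ and $Y$ be $G$-sets. If $\Phi\colon X\to Y$ is an equivalence of $G$-sets, then the map $\tau$ defined by $$\tau(f)=f\circ\Phi^{-1},\qquad f\in L(X),$$ is a linear isomorphism from $L(X)$ to $L(Y)$ that restricts to a linear isomorphism from $L^H(X)$ to $L^H(Y)$ for any subgroup $H$ of $G$. Consequently, if $X$ and $Y$ are equivalent $G$-sets, then $L(X)\cong L(Y)$ and $L^H(X)\cong L^H(Y)$ as vector spaces for any subgroup $H$ of $G$.
   Context: A $G$-set is a nonempty set $X$ with an action of the group $G$, written $a\cdot x$. An equivalence of $G$-sets $X$ and $Y$ is a bijection $\Phi\colon X\to Y$ with $\Phi(a\cdot x)=a\cdot\Phi(x)$ for all $a\in G$, $x\in X$; $X$ and $Y$ are equivalent if such a map exists. $L(X)$ denotes the $\mathbb{F}$-vector space of all functions from $X$ to $\mathbb{F}$ with pointwise operations. For a subgroup $H$ of $G$, acting on $X$ by restriction of the $G$-action, $L^H(X)=\{f\in L(X)\colon f(a\cdot x)=f(x)\text{ for all }a\in H, x\in X\}$. *)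

theory Defs
  imports "HOL-Algebra.Group_Action" "Jordan_Normal_Form.Missing_VectorSpace"
begin

text \<open>
  The vector space $L(X)$ is \<open>ring.func_space F X\<close>: its carrier \<open>X \<rightarrow>\<^sub>E carrier F\<close> consists of functions
  that are \<open>undefined\<close> outside \<open>X\<close>, so that each function from \<open>X\<close> to \<open>F\<close> has one representative.
\<close>

definition G_set :: "('g, 'm) monoid_scheme \<Rightarrow> 'x set \<Rightarrow> ('g \<Rightarrow> 'x \<Rightarrow> 'x) \<Rightarrow> bool"
  where "G_set G X \<phi> \<longleftrightarrow> group_action G X \<phi> \<and> X \<noteq> {}"

definition G_equivalence ::
    "('g, 'm) monoid_scheme \<Rightarrow> 'x set \<Rightarrow> ('g \<Rightarrow> 'x \<Rightarrow> 'x) \<Rightarrow>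
     'y set \<Rightarrow> ('g \<Rightarrow> 'y \<Rightarrow> 'y) \<Rightarrow> ('x \<Rightarrow> 'y) \<Rightarrow> bool"
  where "G_equivalence G X \<phi> Y \<psi> \<Phi> \<longleftrightarrow>
    bij_betw \<Phi> X Y \<and> (\<forall>a\<in>carrier G. \<forall>x\<in>X. \<Phi> (\<phi> a x) = \<psi> a (\<Phi> x))"

definition G_equivalent ::
    "('g, 'm) monoid_scheme \<Rightarrow> 'x set \<Rightarrow> ('g \<Rightarrow> 'x \<Rightarrow> 'x) \<Rightarrow>
     'y set \<Rightarrow> ('g \<Rightarrow> 'y \<Rightarrow> 'y) \<Rightarrow> bool"
  where "G_equivalent G X \<phi> Y \<psi> \<longleftrightarrow> (\<exists>\<Phi>. G_equivalence G X \<phi> Y \<psi> \<Phi>)"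

definition inv_func_space ::
    "('k, 'n) ring_scheme \<Rightarrow> 'g set \<Rightarrow> 'x set \<Rightarrow> ('g \<Rightarrow> 'x \<Rightarrow> 'x) \<Rightarrow> ('k, 'x \<Rightarrow> 'k) module"
  where "inv_func_space F H X \<phi> = (ring.func_space F X)
    \<lparr>carrier := {f \<in> carrier (ring.func_space F X). \<forall>a\<in>H. \<forall>x\<in>X. f (\<phi> a x) = f x}\<rparr>"

text \<open>The locale \<open>linear_map\<close> includes that \<open>V\<close> and \<open>W\<close> are vector spaces over \<open>F\<close>.\<close>

definition linear_isomorphism ::
    "('k, 'n) ring_scheme \<Rightarrow> ('k, 'v, 'p) module_scheme \<Rightarrow> ('k, 'w, 'q) module_scheme \<Rightarrow>
     ('v \<Rightarrow> 'w) \<Rightarrow> bool"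
  where "linear_isomorphism F V W T \<longleftrightarrow>
    linear_map F V W T \<and> bij_betw T (carrier V) (carrier W)"

definition isomorphic_vectorspaces ::
    "('k, 'n) ring_scheme \<Rightarrow> ('k, 'v, 'p) module_scheme \<Rightarrow> ('k, 'w, 'q) module_scheme \<Rightarrow> bool"
  where "isomorphic_vectorspaces F V W \<longleftrightarrow> (\<exists>T. linear_isomorphism F V W T)"

text \<open>
  The map $\tau(f) = f \circ \Phi^{-1}$; the restriction to \<open>Y\<close> makes the value the representative
  in \<open>ring.func_space F Y\<close>.
\<close>

definition transport_map :: "'x set \<Rightarrow> 'y set \<Rightarrow> ('x \<Rightarrow> 'y) \<Rightarrow> ('x \<Rightarrow> 'k) \<Rightarrow> ('y \<Rightarrow> 'k)"
  where "transport_map X Y \<Phi> f = restrict (f \<circ> inv_into X \<Phi>) Y"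

end

theory Submission
  imports Defs
begin

text \<open>Composition with the inverse of \<Phi> is linear because the operations are pointwise,
  and it is undone by composition with \<Phi>. Invariance is preserved both ways because a.\<Phi>(x)
  = \<Phi>(a.x): the transported function takes at this point the value f(a.x), which is to be
  compared with f(x). The argument only uses that H is a set of group elements mapping X and Y into
  themselves, so \<open>linear_isomorphism_transport_map\<close> is proved for every subset H of the
  group. Subgroups give the invariant spaces and H = {} gives the full spaces. The bijection is
  \<open>bij_betw_transport_map\<close>.\<close>

lemma inv_func_space_empty: "inv_func_space F {} X \<phi> = ring.func_space F X"
  by (simp add: inv_func_space_def)

lemma (in field) vectorspace_func_space: "vectorspace R (func_space S)"
  by (simp add: vectorspace_def func_space_is_module field_axioms)

lemma carrier_inv_func_space:
  assumes "ring F"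
  shows "carrier (inv_func_space F H X \<phi>) =
    {f \<in> X \<rightarrow>\<^sub>E carrier F. \<forall>a\<in>H. \<forall>x\<in>X. f (\<phi> a x) = f x}"
  by (simp add: inv_func_space_def ring.func_space_def[OF assms])

lemma add_inv_func_space:
  assumes "ring F"
  shows "f \<oplus>\<^bsub>inv_func_space F H X \<phi>\<^esub> g = (\<lambda>x\<in>X. f x \<oplus>\<^bsub>F\<^esub> g x)"
  by (simp add: inv_func_space_def ring.func_space_def[OF assms])

lemma smult_inv_func_space:
  assumes "ring F"
  shows "c \<odot>\<^bsub>inv_func_space F H X \<phi>\<^esub> f = (\<lambda>x\<in>X. c \<otimes>\<^bsub>F\<^esub> f x)"
  by (simp add: inv_func_space_def ring.func_space_def[OF assms])

text \<open>Invariance is a linear condition, so it cuts out a subspace. Closure of X under H enters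
  because sums and multiples are computed pointwise only on X, and they must be evaluated at
  \<open>\<phi> a x\<close>.\<close>

lemma vectorspace_inv_func_space:
  assumes F: "field F" and closed: "\<And>a x. a \<in> H \<Longrightarrow> x \<in> X \<Longrightarrow> \<phi> a x \<in> X"
  shows "vectorspace F (inv_func_space F H X \<phi>)"
proof -
  interpret F: field F by fact
  interpret L: vectorspace F "F.func_space X" by (rule F.vectorspace_func_space)
  have "submodule F {f \<in> carrier (F.func_space X). \<forall>a\<in>H. \<forall>x\<in>X. f (\<phi> a x) = f x} (F.func_space X)"
  proof (rule submodule.intro)
    show "module F (F.func_space X)" by (rule F.func_space_is_module)
  qed (auto simp: F.func_space_def closed PiE_mem)
  then show ?thesis
    unfolding inv_func_space_def
    by (intro L.subspace_is_vs subspace.intro F.vectorspace_func_space)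
qed

text \<open>Every point of Y has the form \<open>\<Phi> x\<close>, so this equation lets later
  arguments evaluate the transported function without handling the inverse of \<Phi>.\<close>

lemma transport_map_apply:
  assumes "bij_betw \<Phi> X Y" and "x \<in> X"
  shows "transport_map X Y \<Phi> f (\<Phi> x) = f x"
  using assms by (simp add: transport_map_def bij_betw_apply bij_betw_inv_into_left)

lemma bij_betw_transport_map:
  assumes F: "ring F" and equiv: "G_equivalence G X \<phi> Y \<psi> \<Phi>" and H: "H \<subseteq> carrier G"
    and closed: "\<And>a x. a \<in> H \<Longrightarrow> x \<in> X \<Longrightarrow> \<phi> a x \<in> X"
  shows "bij_betw (transport_map X Y \<Phi>)
    (carrier (inv_func_space F H X \<phi>)) (carrier (inv_func_space F H Y \<psi>))"
proof -
  have bij: "bij_betw \<Phi> X Y" and equivariant: "\<And>a x. a \<in> H \<Longrightarrow> x \<in> X \<Longrightarrow> \<psi> a (\<Phi> x) = \<Phi> (\<phi> a x)"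
    using equiv H by (auto simp: G_equivalence_def)
  have Y: "Y = \<Phi> ` X" using bij by (simp add: bij_betw_def)
  note app = transport_map_apply[OF bij]
  show ?thesis
  \<comment> \<open>The inverse map is pullback along \<Phi>, restricted to X so that it yields the
    chosen representative.\<close>
  proof (rule bij_betw_byWitness[where f' = "\<lambda>g. \<lambda>x\<in>X. g (\<Phi> x)"])
    show "\<forall>f\<in>carrier (inv_func_space F H X \<phi>). (\<lambda>x\<in>X. transport_map X Y \<Phi> f (\<Phi> x)) = f"
      by (auto simp: carrier_inv_func_space[OF F] app PiE_def extensional_def fun_eq_iff)
    show "\<forall>g\<in>carrier (inv_func_space F H Y \<psi>). transport_map X Y \<Phi> (\<lambda>x\<in>X. g (\<Phi> x)) = g"
    proof
      fix g assume "g \<in> carrier (inv_func_space F H Y \<psi>)"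
      then have "g \<in> extensional Y" by (simp add: carrier_inv_func_space[OF F] PiE_def)
      then show "transport_map X Y \<Phi> (\<lambda>x\<in>X. g (\<Phi> x)) = g"
        \<comment> \<open>Both sides are \<open>undefined\<close> off Y, so comparing them at the
          points \<open>\<Phi> x\<close> suffices.\<close>
        by (rule extensionalityI[rotated]) (auto simp: Y app[unfolded Y], simp add: transport_map_def)
    qed
    show "transport_map X Y \<Phi> ` carrier (inv_func_space F H X \<phi>) \<subseteq> carrier (inv_func_space F H Y \<psi>)"
    proof (rule image_subsetI)
      fix f assume f: "f \<in> carrier (inv_func_space F H X \<phi>)"
      have "transport_map X Y \<Phi> f \<in> extensional Y" by (simp add: transport_map_def)
      moreover have "\<forall>y\<in>Y. transport_map X Y \<Phi> f y \<in> carrier F"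
        using f by (auto simp: Y carrier_inv_func_space[OF F] app[unfolded Y])
      \<comment> \<open>For y = \<open>\<Phi> x\<close>, equivariance moves the action inside
        \<Phi>, where \<open>app\<close> applies because \<open>\<phi> a x\<close> is again in
        X.\<close>
      moreover have "\<forall>a\<in>H. \<forall>y\<in>Y. transport_map X Y \<Phi> f (\<psi> a y) = transport_map X Y \<Phi> f y"
        using f by (auto simp: Y carrier_inv_func_space[OF F] app[unfolded Y] equivariant closed)
      ultimately show "transport_map X Y \<Phi> f \<in> carrier (inv_func_space F H Y \<psi>)"
        by (simp add: carrier_inv_func_space[OF F] PiE_def)
    qed
    show "(\<lambda>g. \<lambda>x\<in>X. g (\<Phi> x)) ` carrier (inv_func_space F H Y \<psi>) \<subseteq> carrier (inv_func_space F H X \<phi>)"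
      \<comment> \<open>Here equivariance is read in the other direction, turning
        \<open>\<Phi> (\<phi> a x)\<close> into \<open>\<psi> a (\<Phi> x)\<close>, where the
        invariance of \<open>g\<close> applies.\<close>
      by (auto simp: Y carrier_inv_func_space[OF F] closed equivariant[symmetric])
  qed
qed

lemma linear_isomorphism_transport_map:
  assumes F: "field F" and X: "group_action G X \<phi>" and Y: "group_action G Y \<psi>"
    and equiv: "G_equivalence G X \<phi> Y \<psi> \<Phi>" and H: "H \<subseteq> carrier G"
  shows "linear_isomorphism F (inv_func_space F H X \<phi>) (inv_func_space F H Y \<psi>)
    (transport_map X Y \<Phi>)"
proof -
  interpret F: field F by fact
  have bij: "bij_betw \<Phi> X Y" using equiv by (simp add: G_equivalence_def)
  have closed_X: "\<And>a x. a \<in> H \<Longrightarrow> x \<in> X \<Longrightarrow> \<phi> a x \<in> X"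
    and closed_Y: "\<And>a y. a \<in> H \<Longrightarrow> y \<in> Y \<Longrightarrow> \<psi> a y \<in> Y"
    using group_action.element_image[OF X] group_action.element_image[OF Y] H by blast+
  have vs: "vectorspace F (inv_func_space F H X \<phi>)" "vectorspace F (inv_func_space F H Y \<psi>)"
    using closed_X closed_Y by (blast intro: vectorspace_inv_func_space[OF F])+
  have bij': "bij_betw (transport_map X Y \<Phi>)
      (carrier (inv_func_space F H X \<phi>)) (carrier (inv_func_space F H Y \<psi>))"
    by (rule bij_betw_transport_map[OF F.ring_axioms equiv H closed_X])
  \<comment> \<open>Linearity evaluates sums and multiples at these points; the restricted
    operations are pointwise there because the points lie in X.\<close>
  have inv: "\<And>y. y \<in> Y \<Longrightarrow> inv_into X \<Phi> y \<in> X"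
    using bij by (simp add: bij_betw_def inv_into_into)
  have "transport_map X Y \<Phi> \<in> module_hom F (inv_func_space F H X \<phi>) (inv_func_space F H Y \<psi>)"
    unfolding module_hom_def
    using bij_betw_imp_funcset[OF bij']
    by (auto simp: add_inv_func_space[OF F.ring_axioms] smult_inv_func_space[OF F.ring_axioms]
        transport_map_def inv fun_eq_iff)
  then show ?thesis
    using bij' vs
    by (simp add: linear_isomorphism_def linear_map_def mod_hom_def mod_hom_axioms_def vectorspace_def)
qed

theorem proposition2p6:
  fixes F :: "('k, 'n) ring_scheme" and G :: "('g, 'm) monoid_scheme"
    and X :: "'x set" and \<phi> :: "'g \<Rightarrow> 'x \<Rightarrow> 'x"
    and Y :: "'y set" and \<psi> :: "'g \<Rightarrow> 'y \<Rightarrow> 'y"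
  assumes "field F" and "group G" and "G_set G X \<phi>" and "G_set G Y \<psi>"
  shows "(\<forall>\<Phi>. G_equivalence G X \<phi> Y \<psi> \<Phi> \<longrightarrow>
            linear_isomorphism F (ring.func_space F X) (ring.func_space F Y) (transport_map X Y \<Phi>) \<and>
            (\<forall>H. subgroup H G \<longrightarrow>
              linear_isomorphism F (inv_func_space F H X \<phi>) (inv_func_space F H Y \<psi>)
                (transport_map X Y \<Phi>))) \<and>
         (G_equivalent G X \<phi> Y \<psi> \<longrightarrow>
            isomorphic_vectorspaces F (ring.func_space F X) (ring.func_space F Y) \<and>
            (\<forall>H. subgroup H G \<longrightarrow>
              isomorphic_vectorspaces F (inv_func_space F H X \<phi>) (inv_func_space F H Y \<psi>)))"
proof -
  have iso: "linear_isomorphism F (inv_func_space F H X \<phi>) (inv_func_space F H Y \<psi>)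
      (transport_map X Y \<Phi>)" if "G_equivalence G X \<phi> Y \<psi> \<Phi>" "H \<subseteq> carrier G" for \<Phi> H
    using assms that by (intro linear_isomorphism_transport_map) (auto simp: G_set_def)
  have iso_full: "linear_isomorphism F (ring.func_space F X) (ring.func_space F Y)
      (transport_map X Y \<Phi>)" if "G_equivalence G X \<phi> Y \<psi> \<Phi>" for \<Phi>
    \<comment> \<open>The empty set is not a subgroup, which is why \<open>iso\<close> asks only for
      a subset of the carrier.\<close>
    using iso[OF that, of "{}"] by (simp add: inv_func_space_empty)
  show ?thesis
    using iso iso_full subgroup.subset
    unfolding G_equivalent_def isomorphic_vectorspaces_def by blast
qed

end
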